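(* For every integer $r\ge 3$, the wirelength of embedding the hypercube $Q^r$ into the cylinder $C_{2^3}\times P_{2^{r-3}}$ is $$WL\bigl(Q^r,\,C_{2^3}\times P_{2^{r-3}}\bigr)=2^{r_1}\bigl(2^{2r_2-1}-2^{r_2-1}\bigr)+2^{r_2}\bigl(3\cdot 2^{2r_1-3}-2^{r_1-1}\bigr),$$ where $r_1=3$ and $r_2=r-3$.
   Context: Graphs are finite, undirected and simple. $Q^r$ is the $r$-dimensional hypercube: its vertex set is $\{0,1\}^r$, and two vertices are adjacent iff they differ in exactly one entry. $P_d$ is the path with $d$ vertices $0,1,\dots,d-1$ ($P_1$ is a single vertex) and $C_d$ is the cycle with $d$ vertices. The cylinder $C_{d_1}\times P_{d_2}$ is the Cartesian product of the two graphs, i.e. it has vertices $(i,j)$ with $0\le i<d_1$, $0\le j<d_2$, and it is the $d_1\times d_2$ grid together with the wraparound edges joining $(d_1-1,j)$ and $(0,j)$ for each $j$. Let $G$ and $H$ be finite graphs with the same number of vertices. An embedding $f$ of $G$ into $H$ consists of a bijection $f:V(G)\to V(H)$ together with a one-to-one map assigning to each edge $(u,v)\in E(G)$ a path $Path_f(u,v)$ in $H$ between $f(u)$ and $f(v)$. The wirelength of $f$ is $WL_f(G,H)=\sum_{(u,v)\in E(G)} d_H(f(u),f(v))$, where $d_H(f(u),f(v))$ denotes the length (number of edges) of the path $Path_f(u,v)$. The wirelength of embedding $G$ into $H$ is $WL(G,H)=\min_f WL_f(G,H)$, the minimum over all embeddings $f$ of $G$ into $H$. The formula is evaluated in the rational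 numbers (when $r_2=0$ it involves $2^{-1}$). *)

theory Defs
  imports Complex_Main
begin

datatype 'a graph = Graph (verts: "'a set") (edges: "'a set set")

definition simple_graph :: "'a graph \<Rightarrow> bool" where
  "simple_graph G \<longleftrightarrow> finite (verts G) \<and>
     (\<forall>e\<in>edges G. \<exists>u\<in>verts G. \<exists>v\<in>verts G. u \<noteq> v \<and> e = {u, v})"

(* Entries 0 and 1 are encoded as False and True. *)
definition hypercube :: "nat \<Rightarrow> bool list graph" where
  "hypercube r = Graph {xs. length xs = r}
     {{xs, ys} | xs ys. length xs = r \<and> length ys = r \<and> card {i. i < r \<and> xs ! i \<noteq> ys ! i} = 1}"

definition path_graph :: "nat \<Rightarrow> nat graph" where
  "path_graph d = Graph {..<d} {{i, Suc i} | i. Suc i < d}"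

(* Intended for d \<ge> 3: for d = 1 this has a loop, and for d = 2 it is a single edge. *)
definition cycle_graph :: "nat \<Rightarrow> nat graph" where
  "cycle_graph d = Graph {..<d} {{i, Suc i mod d} | i. i < d}"

definition cartesian_product :: "'a graph \<Rightarrow> 'b graph \<Rightarrow> ('a \<times> 'b) graph" where
  "cartesian_product G H = Graph (verts G \<times> verts H)
     ({{(a, x), (b, x)} | a b x. {a, b} \<in> edges G \<and> x \<in> verts H} \<union>
      {{(a, x), (a, y)} | a x y. a \<in> verts G \<and> {x, y} \<in> edges H})"

definition cylinder :: "nat \<Rightarrow> nat \<Rightarrow> (nat \<times> nat) graph" where
  "cylinder d1 d2 = cartesian_product (cycle_graph d1) (path_graph d2)"

(* A path is given by its list of vertices. *)
definition is_path :: "'a graph \<Rightarrow> 'a list \<Rightarrow> bool" where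
  "is_path G p \<longleftrightarrow> p \<noteq> [] \<and> distinct p \<and> set p \<subseteq> verts G \<and>
     (\<forall>i. Suc i < length p \<longrightarrow> {p ! i, p ! Suc i} \<in> edges G)"

definition path_length :: "'a list \<Rightarrow> nat" where
  "path_length p = length p - 1"

(* Edges are unordered, so the direction in which the list P e runs between the images
   of the two ends of e is left open. Distinct edges have distinct pairs of end images, so
   identifying a list with its reversal would not change the injectivity condition. *)
definition is_embedding :: "'a graph \<Rightarrow> 'b graph \<Rightarrow> ('a \<Rightarrow> 'b) \<Rightarrow> ('a set \<Rightarrow> 'b list) \<Rightarrow> bool" where
  "is_embedding G H f P \<longleftrightarrow> bij_betw f (verts G) (verts H) \<and> inj_on P (edges G) \<and>
     (\<forall>e\<in>edges G. is_path H (P e) \<and> {hd (P e), last (P e)} = f ` e)"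

definition embedding_wirelength :: "'a graph \<Rightarrow> ('a set \<Rightarrow> 'b list) \<Rightarrow> nat" where
  "embedding_wirelength G P = (\<Sum>e\<in>edges G. path_length (P e))"

(* Inf of a nonempty set of naturals is its minimum; Inf {} = 0. *)
definition wirelength :: "'a graph \<Rightarrow> 'b graph \<Rightarrow> nat" where
  "wirelength G H = Inf {embedding_wirelength G P | f P. is_embedding G H f P}"

lemma simple_graph_hypercube: "simple_graph (hypercube r)"
proof -
  have "finite {xs :: bool list. length xs = r}"
    using finite_lists_length_eq[of "UNIV :: bool set" r] by simp
  moreover have "xs \<noteq> ys" if "card {i. i < r \<and> xs ! i \<noteq> ys ! i} = 1" for xs ys :: "bool list"
    using that by auto
  ultimately show ?thesis
    unfolding simple_graph_def hypercube_def graph.sel by blast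
qed

lemma card_verts_hypercube: "card (verts (hypercube r)) = 2 ^ r"
  using card_lists_length_eq[of "UNIV :: bool set" r] by (simp add: hypercube_def)

lemma simple_graph_path_graph: "simple_graph (path_graph d)"
proof -
  have "i \<in> {..<d} \<and> Suc i \<in> {..<d} \<and> i \<noteq> Suc i" if "Suc i < d" for i
    using that by simp
  then show ?thesis
    unfolding simple_graph_def path_graph_def graph.sel by blast
qed

lemma simple_graph_cycle_graph:
  assumes "d \<ge> 3"
  shows "simple_graph (cycle_graph d)"
proof -
  have "i \<in> {..<d} \<and> Suc i mod d \<in> {..<d} \<and> i \<noteq> Suc i mod d" if "i < d" for i
    using that assms by (auto simp: mod_Suc)
  then show ?thesis
    unfolding simple_graph_def cycle_graph_def graph.sel by blast
qed

lemma simple_graph_cartesian_product: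
  assumes "simple_graph G" "simple_graph H"
  shows "simple_graph (cartesian_product G H)"
proof -
  have G: "a \<in> verts G \<and> b \<in> verts G \<and> a \<noteq> b" if "{a, b} \<in> edges G" for a b
    using assms(1) that unfolding simple_graph_def by (metis doubleton_eq_iff)
  have H: "a \<in> verts H \<and> b \<in> verts H \<and> a \<noteq> b" if "{a, b} \<in> edges H" for a b
    using assms(2) that unfolding simple_graph_def by (metis doubleton_eq_iff)
  have "\<exists>u\<in>verts G \<times> verts H. \<exists>v\<in>verts G \<times> verts H. u \<noteq> v \<and> e = {u, v}"
    if "e \<in> edges (cartesian_product G H)" for e
  proof -
    from that consider
        (1) a b x where "e = {(a, x), (b, x)}" "{a, b} \<in> edges G" "x \<in> verts H"
      | (2) a x y where "e = {(a, x), (a, y)}" "a \<in> verts G" "{x, y} \<in> edges H"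
      by (auto simp: cartesian_product_def)
    then show ?thesis
    proof cases
      case 1
      then show ?thesis
        using G[OF 1(2)] by (intro bexI[of _ "(a, x)"] bexI[of _ "(b, x)"]) auto
    next
      case 2
      then show ?thesis
        using H[OF 2(3)] by (intro bexI[of _ "(a, x)"] bexI[of _ "(a, y)"]) auto
    qed
  qed
  with assms show ?thesis
    by (simp add: simple_graph_def cartesian_product_def)
qed

lemma simple_graph_cylinder: "d1 \<ge> 3 \<Longrightarrow> simple_graph (cylinder d1 d2)"
  unfolding cylinder_def
  by (intro simple_graph_cartesian_product simple_graph_cycle_graph simple_graph_path_graph)

lemma card_verts_cylinder: "card (verts (cylinder d1 d2)) = d1 * d2"
  by (simp add: cylinder_def cartesian_product_def cycle_graph_def path_graph_def)

end

theory Submission imports Defs begin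

text \<open>
Write \<open>s = r - 3\<close>. A path in the cylinder is at least as long as the number of cuts separating its ends,
where the cuts are the \<open>2 ^ s - 1\<close> nontrivial horizontal ones and the four vertical ones between
opposite halves of the cycle. The preimage of each horizontal cut is bounded by the edge-isoperimetric
inequality for \<open>8 * k\<close> vertices. The same bound applied to a single vertical cut is too weak:
it gives \<open>16 * 2 ^ s\<close> in total instead of \<open>20 * 2 ^ s\<close>. Instead, two consecutive vertical cuts are
replaced, by submodularity, with their intersection and union, which have \<open>3 * 2 ^ s\<close> and
\<open>5 * 2 ^ s\<close> vertices and hence at least \<open>5 * 2 ^ s\<close> boundary edges each. The bound is attained by
a Gray code on three coordinates and binary numbering on the others.
\<close>

section \<open>The edge-isoperimetric inequality in the hypercube\<close>

text \<open>If the ends of an edge agree in the first coordinate, the edge lies in one of two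
  subcubes; if they differ there, they agree everywhere else. The edge sums and inductions over
  hypercubes rest on this.\<close>

lemma edges_hypercube_Suc:
  "edges (hypercube (Suc r)) =
     (`) (Cons False) ` edges (hypercube r) \<union> (`) (Cons True) ` edges (hypercube r) \<union>
     (\<lambda>xs. {False # xs, True # xs}) ` verts (hypercube r)" (is "?L = ?R")
proof -
  have differ: "card {i. i < Suc r \<and> (b # xs) ! i \<noteq> (c # ys) ! i} =
      of_bool (b \<noteq> c) + card {i. i < r \<and> xs ! i \<noteq> ys ! i}" for b c xs and ys :: "bool list"
  proof -
    have "{i. i < Suc r \<and> (b # xs) ! i \<noteq> (c # ys) ! i} =
        (if b \<noteq> c then {0} else {}) \<union> Suc ` {i. i < r \<and> xs ! i \<noteq> ys ! i}"
      by (auto simp: less_Suc_eq_0_disj)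
    then show ?thesis
      by (auto simp: card_image)
  qed
  have same: "card {i. i < r \<and> xs ! i \<noteq> ys ! i} = 0 \<longleftrightarrow> xs = ys"
    if "length xs = r" "length ys = r" for xs ys :: "bool list"
    using that by (auto simp: list_eq_iff_nth_eq)
  have edgeI: "{xs, ys} \<in> edges (hypercube n)"
    if "length xs = n" "length ys = n" "card {i. i < n \<and> xs ! i \<noteq> ys ! i} = 1" for n xs ys
    using that unfolding hypercube_def graph.sel by blast
  have "e \<in> ?R" if "e \<in> ?L" for e
  proof -
    from that obtain us vs where e: "e = {us, vs}" "length us = Suc r" "length vs = Suc r"
      and uv: "card {i. i < Suc r \<and> us ! i \<noteq> vs ! i} = 1"
      by (auto simp: hypercube_def)
    then obtain b xs c ys where bc: "us = b # xs" "vs = c # ys"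
      by (metis length_Suc_conv)
    have len: "length xs = r" "length ys = r"
      using e bc by auto
    show ?thesis
    proof (cases "b = c")
      case True
      then have "card {i. i < r \<and> xs ! i \<noteq> ys ! i} = 1"
        using uv differ[of b xs c ys] bc by simp
      with len have "{xs, ys} \<in> edges (hypercube r)"
        by (rule edgeI)
      moreover have "e = Cons b ` {xs, ys}"
        using e(1) bc True by simp
      ultimately have "e \<in> (`) (Cons b) ` edges (hypercube r)"
        by (rule rev_image_eqI)
      then show ?thesis
        by (cases b) simp_all
    next
      case False
      then have "xs = ys"
        using uv differ[of b xs c ys] same[OF len] bc by simp
      moreover have "e = {False # xs, True # xs}"
        using False e(1) bc \<open>xs = ys\<close> by (cases b) (simp_all add: insert_commute)
      ultimately show ?thesis
        using len(1) by (auto simp: hypercube_def)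
    qed
  qed
  moreover have "Cons b ` e \<in> ?L" if "e \<in> edges (hypercube r)" for b e
  proof -
    from that obtain xs ys where e: "e = {xs, ys}" and len: "length xs = r" "length ys = r"
      and "card {i. i < r \<and> xs ! i \<noteq> ys ! i} = 1"
      by (auto simp: hypercube_def)
    then have "{b # xs, b # ys} \<in> ?L"
      by (intro edgeI) (simp_all only: differ, simp_all)
    with e show ?thesis
      by simp
  qed
  moreover have "{False # xs, True # xs} \<in> ?L" if "xs \<in> verts (hypercube r)" for xs
    using that by (intro edgeI) (simp_all only: differ, simp_all add: hypercube_def)
  ultimately show ?thesis
    by blast
qed

lemma simple_graph_edgeE:
  assumes "simple_graph G" "e \<in> edges G"
  obtains u v where "u \<in> verts G" "v \<in> verts G" "u \<noteq> v" "e = {u, v}"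
  using assms unfolding simple_graph_def by blast

lemma finite_edges_simple_graph:
  assumes "simple_graph G"
  shows "finite (edges G)"
proof (rule finite_subset)
  show "edges G \<subseteq> Pow (verts G)"
    using assms by (auto elim!: simple_graph_edgeE)
  show "finite (Pow (verts G))"
    using assms by (simp add: simple_graph_def)
qed

lemma verts_hypercube: "verts (hypercube r) = {xs. length xs = r}"
  by (simp add: hypercube_def)

lemma finite_verts_hypercube [simp]: "finite (verts (hypercube r))"
  using simple_graph_hypercube by (auto simp: simple_graph_def)

lemma finite_edges_hypercube [simp]: "finite (edges (hypercube r))"
  using simple_graph_hypercube by (rule finite_edges_simple_graph)

lemma edges_hypercube_0: "edges (hypercube 0) = {}"
  by (auto simp: hypercube_def)

lemma verts_hypercube_Suc:
  "verts (hypercube (Suc r)) = Cons False ` verts (hypercube r) \<union> Cons True ` verts (hypercube r)"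
proof -
  have "xs \<in> Cons False ` {ys. length ys = r} \<union> Cons True ` {ys. length ys = r}"
    if "length xs = Suc r" for xs
    using that by (cases xs; cases "hd xs") auto
  then show ?thesis
    by (auto simp: verts_hypercube)
qed

lemma edge_hypercube_Suc_cases:
  assumes "e \<in> edges (hypercube (Suc r))"
  obtains (same) b e' where "e = Cons b ` e'" "e' \<in> edges (hypercube r)"
    | (flip) xs where "e = {False # xs, True # xs}" "length xs = r"
  using assms unfolding edges_hypercube_Suc verts_hypercube by blast

lemma sum_verts_hypercube_Suc:
  "sum g (verts (hypercube (Suc r))) =
     (\<Sum>xs\<in>verts (hypercube r). g (False # xs)) + (\<Sum>xs\<in>verts (hypercube r). g (True # xs))"
  unfolding verts_hypercube_Suc
  by (subst sum.union_disjoint) (auto simp: sum.reindex)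

lemma sum_edges_hypercube_Suc:
  fixes g :: "bool list set \<Rightarrow> 'a::comm_monoid_add"
  shows "sum g (edges (hypercube (Suc r))) =
     (\<Sum>e\<in>edges (hypercube r). g (Cons False ` e)) + (\<Sum>e\<in>edges (hypercube r). g (Cons True ` e)) +
     (\<Sum>xs\<in>verts (hypercube r). g {False # xs, True # xs})"
proof -
  \<comment> \<open>An empty set would have the same image under both \<open>Cons\<close> maps, so
    disjointness needs inhabited edges.\<close>
  have nonempty: "\<exists>x. x \<in> e" if "e \<in> edges (hypercube r)" for e
    using that simple_graph_edgeE[OF simple_graph_hypercube] by blast
  have "Cons False ` e \<noteq> Cons True ` e'" if "e \<in> edges (hypercube r)" for e e'
    using nonempty[OF that] by auto
  then have 1: "(`) (Cons False) ` edges (hypercube r) \<inter> (`) (Cons True) ` edges (hypercube r) = {}"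
    by blast
  have "Cons b ` e \<noteq> {False # xs, True # xs}" for b e xs
    by (cases b) auto
  then have 2: "((`) (Cons False) ` edges (hypercube r) \<union> (`) (Cons True) ` edges (hypercube r)) \<inter>
      (\<lambda>xs. {False # xs, True # xs}) ` verts (hypercube r) = {}"
    by blast
  have 3: "inj_on ((`) (Cons b)) A" for b :: bool and A
    by (rule inj_onI) (simp add: inj_image_eq_iff)
  have 4: "inj_on (\<lambda>xs. {False # xs, True # xs}) A" for A
    by (rule inj_onI) (auto simp: doubleton_eq_iff)
  show ?thesis
    unfolding edges_hypercube_Suc
    by (subst sum.union_disjoint[OF _ _ 2], simp, simp,
        subst sum.union_disjoint[OF _ _ 1], simp, simp)
       (simp add: sum.reindex[OF 3] sum.reindex[OF 4])
qed

section \<open>Edge cuts and submodularity\<close>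

definition separates :: "'a set \<Rightarrow> 'a set \<Rightarrow> bool" where
  "separates W X \<longleftrightarrow> X \<inter> W \<noteq> {} \<and> \<not> X \<subseteq> W"

lemma separates_doubleton: "separates W {u, v} \<longleftrightarrow> (u \<in> W) \<noteq> (v \<in> W)"
  by (auto simp: separates_def)

text \<open>Speaking of whole sets rather than pairs pays off here: a cut of the host graph pulls
  back to a cut of the guest graph.\<close>

lemma separates_image: "separates W (f ` X) \<longleftrightarrow> separates (f -` W) X"
  by (auto simp: separates_def)

lemma separates_Compl: "separates (- W) X \<longleftrightarrow> separates W X"
  by (auto simp: separates_def)

text \<open>A sum of indicators lets inequalities be checked edge by edge and sums over cuts and
  edges be exchanged.\<close>

definition cut_size :: "'a graph \<Rightarrow> 'a set \<Rightarrow> nat" where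
  "cut_size G S = (\<Sum>e\<in>edges G. of_bool (separates S e))"

lemma cut_size_cong:
  assumes "simple_graph G" "\<And>x. x \<in> verts G \<Longrightarrow> x \<in> S \<longleftrightarrow> x \<in> T"
  shows "cut_size G S = cut_size G T"
  unfolding cut_size_def
proof (rule sum.cong)
  fix e assume "e \<in> edges G"
  with assms(1) obtain u v where "u \<in> verts G" "v \<in> verts G" "e = {u, v}"
    by (rule simple_graph_edgeE)
  with assms(2) show "of_bool (separates S e) = of_bool (separates T e)"
    by (simp add: separates_doubleton)
qed simp

text \<open>Holds edge by edge: an edge cut by both intersection and union is cut by both sets, and
  an edge cut by either of them is cut by at least one set.\<close>

lemma cut_size_submodular:
  assumes "simple_graph G"
  shows "cut_size G (S \<inter> T) + cut_size G (S \<union> T) \<le> cut_size G S + cut_size G T"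
  unfolding cut_size_def sum.distrib[symmetric]
proof (rule sum_mono)
  fix e assume "e \<in> edges G"
  with assms obtain u v where "e = {u, v}"
    by (rule simple_graph_edgeE)
  then show "of_bool (separates (S \<inter> T) e) + of_bool (separates (S \<union> T) e)
      \<le> (of_bool (separates S e) + of_bool (separates T e) :: nat)"
    by (auto simp: separates_doubleton)
qed

text \<open>The number of edges spanned by the first \<open>m\<close> vertices of the hypercube in binary order.\<close>

fun binary_edges :: "nat \<Rightarrow> nat" where
  "binary_edges m = (if m \<le> 1 then 0
     else binary_edges (m div 2) + binary_edges (m - m div 2) + m div 2)"

declare binary_edges.simps [simp del]

lemma binary_edges_0 [simp]: "binary_edges 0 = 0"
  and binary_edges_1 [simp]: "binary_edges (Suc 0) = 0"
  by (simp_all add: binary_edges.simps)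

lemma binary_edges_even: "binary_edges (2 * m) = 2 * binary_edges m + m"
proof (cases m)
  case (Suc k)
  have "2 * m - m = m" by simp
  with Suc show ?thesis by (subst binary_edges.simps) simp
qed simp

lemma binary_edges_odd:
  "binary_edges (Suc (2 * m)) = binary_edges m + binary_edges (Suc m) + m"
proof (cases m)
  case (Suc k)
  have "Suc (2 * m) - m = Suc m" "Suc (2 * m) div 2 = m" by simp_all
  with Suc show ?thesis by (subst binary_edges.simps) simp
qed simp

text \<open>The segment consists of \<open>k\<close> subcubes of dimension \<open>j\<close>, with
  \<open>2 ^ j\<close> parallel edges for each edge among the first \<open>k\<close> vertices. The
  factor 2 avoids halving \<open>j * 2 ^ j\<close>.\<close>

lemma binary_edges_power: "2 * binary_edges (2 ^ j * k) = 2 ^ j * (2 * binary_edges k + j * k)"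
proof (induction j)
  case (Suc j)
  have "binary_edges (2 ^ Suc j * k) = 2 * binary_edges (2 ^ j * k) + 2 ^ j * k"
    using binary_edges_even[of "2 ^ j * k"] by (simp add: mult.assoc)
  with Suc show ?case
    by (simp add: algebra_simps)
qed simp

text \<open>Needed for the isoperimetric induction: parts of sizes \<open>m\<close> and
  \<open>n\<close> in opposite subcubes have at most \<open>min m n\<close> edges between them. Both
  arguments are halved, by parity.\<close>

lemma binary_edges_superadditive:
  "binary_edges m + binary_edges n + min m n \<le> binary_edges (m + n)"
proof (induction "m + n" arbitrary: m n rule: less_induct)
  case less
  show ?case
  \<comment> \<open>For \<open>m = 1\<close>, \<open>n = 0\<close> rounding up would not decrease
    the sum, so zero arguments are handled apart.\<close>
  proof (cases "m = 0 \<or> n = 0")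
    case True
    then show ?thesis by auto
  next
    case False
    obtain a where a: "m = 2 * a \<or> m = Suc (2 * a)"
      by (metis oddE evenE Suc_eq_plus1)
    obtain c where c: "n = 2 * c \<or> n = Suc (2 * c)"
      by (metis oddE evenE Suc_eq_plus1)
    from a c consider
        (ee) "m = 2 * a" "n = 2 * c" | (oe) "m = Suc (2 * a)" "n = 2 * c"
      | (eo) "m = 2 * a" "n = Suc (2 * c)" | (oo) "m = Suc (2 * a)" "n = Suc (2 * c)"
      by blast
    then show ?thesis
    proof cases
      case ee
      have "m + n = 2 * (a + c)" using ee by simp
      then show ?thesis
        using less[of a c] False ee by (simp only: binary_edges_even) linarith
    next
      case oe
      have "m + n = Suc (2 * (a + c))" using oe by simp
      then show ?thesis
        using less[of a c] less[of "Suc a" c] False oe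
        by (simp only: binary_edges_even binary_edges_odd) auto
    next
      case eo
      have "m + n = Suc (2 * (a + c))" using eo by simp
      then show ?thesis
        using less[of a c] less[of a "Suc c"] False eo
        by (simp only: binary_edges_even binary_edges_odd) auto
    next
      case oo
      \<comment> \<open>The halves are paired crosswise, so that both inductive sums equal
        \<open>Suc (a + c)\<close>, as the even recursion requires.\<close>
      have "m + n = 2 * (Suc (a + c))" using oo by simp
      then show ?thesis
        using less[of a "Suc c"] less[of "Suc a" c] False oo
        by (simp only: binary_edges_even binary_edges_odd) auto
    qed
  qed
qed

text \<open>Since \<open>r * card S\<close> is the degree sum over \<open>S\<close>, this says that
  \<open>S\<close> spans at most as many edges as a binary initial segment of the same size. The
  induction splits \<open>S\<close> by the first coordinate.\<close>

theorem hypercube_edge_isoperimetric: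
  assumes "S \<subseteq> verts (hypercube r)"
  shows "r * card S \<le> cut_size (hypercube r) S + 2 * binary_edges (card S)"
  using assms
proof (induction r arbitrary: S)
  case (Suc r)
  define A where "A b = {xs. b # xs \<in> S}" for b
  have sub: "A b \<subseteq> verts (hypercube r)" for b
    using Suc.prems by (auto simp: A_def verts_hypercube)
  have fin [simp]: "finite (A b)" for b
    using sub finite_verts_hypercube by (rule finite_subset)
  have "x \<in> Cons False ` A False \<union> Cons True ` A True" if "x \<in> S" for x
    using that Suc.prems by (cases x; cases "hd x") (auto simp: A_def verts_hypercube)
  then have "S = Cons False ` A False \<union> Cons True ` A True"
    by (auto simp: A_def)
  moreover have "card (Cons False ` A False \<union> Cons True ` A True) = card (A False) + card (A True)"
    by (subst card_Un_disjoint) (auto simp: card_image)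
  ultimately have card_S: "card S = card (A False) + card (A True)"
    by simp
  \<comment> \<open>An edge in the first coordinate is cut exactly when its tail lies in one of the
    two halves only.\<close>
  let ?D = "(A False - A True) \<union> (A True - A False)"
  have "(\<Sum>xs\<in>verts (hypercube r). of_bool (separates S {False # xs, True # xs})) =
      (\<Sum>xs\<in>verts (hypercube r). of_bool (xs \<in> ?D) :: nat)"
    by (rule sum.cong) (auto simp: separates_doubleton A_def)
  also have "\<dots> = card ?D"
    using sub by (auto simp: sum.If_cases of_bool_def intro!: arg_cong[where f = card])
  finally have cross: "(\<Sum>xs\<in>verts (hypercube r). of_bool (separates S {False # xs, True # xs}))
      = card ?D" .
  have pull: "separates S (Cons b ` e) \<longleftrightarrow> separates (A b) e" for b e
    by (simp add: separates_image A_def vimage_def)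
  have cut: "cut_size (hypercube (Suc r)) S =
      cut_size (hypercube r) (A False) + cut_size (hypercube r) (A True) + card ?D"
    by (simp add: cut_size_def sum_edges_hypercube_Suc cross pull)
  \<comment> \<open>The symmetric difference is at least the difference in size, and
    \<open>m + n\<close> is that difference plus \<open>2 * min m n\<close>. Twice the
    superadditivity bound absorbs the minimum.\<close>
  have "card (A False) - card (A True) \<le> card ?D" "card (A True) - card (A False) \<le> card ?D"
    by (meson diff_card_le_card_Diff fin card_mono finite_Un finite_Diff Un_upper1 Un_upper2 le_trans)+
  then have "card (A False) + card (A True) \<le> card ?D + 2 * min (card (A False)) (card (A True))"
    by linarith
  with Suc.IH[OF sub, of False] Suc.IH[OF sub, of True]
    binary_edges_superadditive[of "card (A False)" "card (A True)"]
  show ?case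
    unfolding cut card_S by (simp add: algebra_simps)
qed (simp add: cut_size_def)

section \<open>Lower bound\<close>

text \<open>If no step changes sides, both ends lie on the same side; the induction peels off the
  first step.\<close>

lemma separates_ends_le_steps:
  assumes "p \<noteq> []"
  shows "of_bool (separates W {hd p, last p}) \<le>
    (\<Sum>i<path_length p. of_bool (separates W {p ! i, p ! Suc i}) :: nat)"
  using assms
proof (induction p rule: list_nonempty_induct)
  case (cons x p)
  then obtain y q where p: "p = y # q"
    by (cases p) auto
  have "(\<Sum>i<path_length (x # p). of_bool (separates W {(x # p) ! i, (x # p) ! Suc i}) :: nat) =
      of_bool (separates W {x, y}) + (\<Sum>i<path_length p. of_bool (separates W {p ! i, p ! Suc i}))"
    by (simp add: path_length_def p sum.lessThan_Suc_shift del: sum.lessThan_Suc)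
  with cons p show ?case
    by (auto simp: separates_doubleton split: if_splits)
qed (auto simp: separates_def)

text \<open>Each step of a path crosses at most one cut, so the path is at least as long as the
  number of cuts separating its ends. Summing over edges and exchanging sums leaves cut sizes in
  \<open>G\<close>.\<close>

lemma embedding_wirelength_ge_cuts:
  assumes emb: "is_embedding G H f P"
    and cuts: "\<And>e. e \<in> edges H \<Longrightarrow> (\<Sum>i\<in>I. of_bool (separates (C i) e)) \<le> (1::nat)"
  shows "(\<Sum>i\<in>I. cut_size G (f -` C i)) \<le> embedding_wirelength G P"
proof -
  have "(\<Sum>i\<in>I. of_bool (separates (C i) (f ` e))) \<le> path_length (P e)" if "e \<in> edges G" for e
  proof -
    from emb that have path: "is_path H (P e)" and ends: "f ` e = {hd (P e), last (P e)}"
      by (auto simp: is_embedding_def)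
    have "(\<Sum>i\<in>I. of_bool (separates (C i) (f ` e)) :: nat) \<le>
        (\<Sum>i\<in>I. \<Sum>j<path_length (P e). of_bool (separates (C i) {P e ! j, P e ! Suc j}))"
      using path unfolding ends by (intro sum_mono separates_ends_le_steps) (simp add: is_path_def)
    also have "\<dots> = (\<Sum>j<path_length (P e). \<Sum>i\<in>I. of_bool (separates (C i) {P e ! j, P e ! Suc j}))"
      by (rule sum.swap)
    also have "\<dots> \<le> (\<Sum>j<path_length (P e). 1)"
      using path by (intro sum_mono cuts) (auto simp: is_path_def path_length_def)
    finally show ?thesis
      by simp
  qed
  then have "(\<Sum>e\<in>edges G. \<Sum>i\<in>I. of_bool (separates (C i) (f ` e))) \<le> embedding_wirelength G P"
    unfolding embedding_wirelength_def by (rule sum_mono)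
  then show ?thesis
    unfolding cut_size_def separates_image by (subst sum.swap)
qed

section \<open>Cuts of the cylinder\<close>

definition row_cut :: "nat \<Rightarrow> (nat \<times> nat) set" where
  "row_cut k = {p. snd p < k}"

text \<open>For \<open>i \<le> 4\<close>, half of the 8-cycle, bounded in each row by two antipodal
  cycle edges.\<close>

definition column_cut :: "nat \<Rightarrow> (nat \<times> nat) set" where
  "column_cut i = {p. fst p \<in> {i..<i + 4}}"

text \<open>The cuts have disjoint boundaries: the four column cuts share out the cycle edges in
  antipodal pairs, and a vertical edge crosses only the row cut at its upper end.
  \<open>row_cut 0\<close> is empty.\<close>

lemma cylinder_edge_separations:
  assumes "e \<in> edges (cylinder 8 n)"
  shows "(\<Sum>i\<in>{..<4} <+> {..<n}. of_bool (separates (case_sum column_cut row_cut i) e)) \<le> (1::nat)"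
proof -
  have four: "(\<Sum>i<4. g i) = g 0 + g 1 + g 2 + g 3" for g :: "nat \<Rightarrow> nat"
    by (simp add: eval_nat_numeral)
  have split: "(\<Sum>i\<in>{..<4} <+> {..<n}. of_bool (separates (case_sum column_cut row_cut i) e)) =
      (\<Sum>i<4. of_bool (separates (column_cut i) e)) + (\<Sum>k<n. of_bool (separates (row_cut k) e) :: nat)"
    by (subst sum.Plus) (simp_all only: finite_lessThan comp_def sum.case)
  from assms consider
      (c) a b x where "e = {(a, x), (b, x)}" "{a, b} \<in> edges (cycle_graph 8)"
    | (p) a x y where "e = {(a, x), (a, y)}" "{x, y} \<in> edges (path_graph n)"
    by (auto simp: cylinder_def cartesian_product_def)
  then show ?thesis
  proof cases
    case c
    from c(2) obtain i where "i < 8" "{a, b} = {i, Suc i mod 8}"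
      by (auto simp: cycle_graph_def)
    then have e: "e = {(i, x), (Suc i mod 8, x)}"
      using c(1) by (auto simp: doubleton_eq_iff)
    have "i = 0 \<or> i = 1 \<or> i = 2 \<or> i = 3 \<or> i = 4 \<or> i = 5 \<or> i = 6 \<or> i = 7"
      using \<open>i < 8\<close> by linarith
    then have "(\<Sum>i<4. of_bool (separates (column_cut i) e)) \<le> (1::nat)"
      unfolding e four
      by (elim disjE) (simp_all add: separates_doubleton column_cut_def)
    moreover have "(\<Sum>k<n. of_bool (separates (row_cut k) e)) = (0::nat)"
      unfolding e by (rule sum.neutral) (simp add: separates_doubleton row_cut_def)
    ultimately show ?thesis
      unfolding split by simp
  next
    case p
    from p(2) obtain i where "Suc i < n" "{x, y} = {i, Suc i}"
      by (auto simp: path_graph_def)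
    then have e: "e = {(a, i), (a, Suc i)}"
      using p(1) by (auto simp: doubleton_eq_iff)
    have "(\<Sum>k<n. of_bool (separates (row_cut k) e)) = (\<Sum>k<n. of_bool (k = Suc i) :: nat)"
      unfolding e by (rule sum.cong) (auto simp: separates_doubleton row_cut_def)
    also have "\<dots> = 1"
      using \<open>Suc i < n\<close> by (simp add: of_bool_def)
    moreover have "(\<Sum>i<4. of_bool (separates (column_cut i) e)) = (0::nat)"
      unfolding e by (rule sum.neutral) (simp add: separates_doubleton column_cut_def)
    ultimately show ?thesis
      unfolding split by simp
  qed
qed

lemma cut_size_preimage_ge:
  assumes bij: "bij_betw f (verts (hypercube r)) (verts H)" and "C \<inter> verts H = D" "card D = m"
  shows "r * m \<le> cut_size (hypercube r) (f -` C) + 2 * binary_edges m"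
proof -
  \<comment> \<open>The map is controlled only on the vertices, so the preimage is restricted to
    them; this leaves the cut size unchanged.\<close>
  let ?S = "f -` C \<inter> verts (hypercube r)"
  have "f ` ?S = C \<inter> f ` verts (hypercube r)"
    by auto
  then have "f ` ?S = D"
    using bij assms(2) by (simp add: bij_betw_def)
  moreover have "inj_on f ?S"
    using bij by (auto simp: bij_betw_def intro: inj_on_subset)
  ultimately have "card ?S = m"
    using assms(3) card_image by metis
  moreover have "cut_size (hypercube r) ?S = cut_size (hypercube r) (f -` C)"
    by (rule cut_size_cong[OF simple_graph_hypercube]) auto
  ultimately show ?thesis
    using hypercube_edge_isoperimetric[of ?S r] by simp
qed

lemma verts_cylinder: "verts (cylinder d n) = {..<d} \<times> {..<n}"
  by (simp add: cylinder_def cartesian_product_def cycle_graph_def path_graph_def)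

text \<open>Totals the boundaries \<open>s * k - 2 * binary_edges k\<close> of the binary initial
  segments, for use with the row cuts. Doubling the range pairs \<open>2 * k\<close> with
  \<open>Suc (2 * k)\<close>, where the recursion for \<open>binary_edges\<close> applies.\<close>

lemma sum_binary_edges:
  "2 * (\<Sum>k<2 ^ s. s * k) = 4 * (\<Sum>k<2 ^ s. binary_edges k) + 2 ^ s * (2 ^ s - 1)"
proof (induction s)
  case (Suc s)
  have split: "(\<Sum>k<2 * n. g k) = (\<Sum>k<n. g (2 * k) + g (Suc (2 * k)))" for g :: "nat \<Rightarrow> nat" and n
    by (induction n) auto
  have shift: "(\<Sum>k<n. binary_edges (Suc k)) = (\<Sum>k<n. binary_edges k) + binary_edges n" for n
    by (induction n) auto
  define n :: nat where "n = 2 ^ s"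
  have gauss: "2 * (\<Sum>k<n. k) + n = n * n" for n :: nat
    by (induction n) auto
  have "2 * binary_edges n = s * n"
    using binary_edges_power[of s 1] by (simp add: n_def)
  moreover have "(\<Sum>k<2 * n. binary_edges k) =
      4 * (\<Sum>k<n. binary_edges k) + binary_edges n + 2 * (\<Sum>k<n. k)"
    by (simp add: split binary_edges_even binary_edges_odd sum.distrib shift
        sum_distrib_left[symmetric])
  moreover have "(\<Sum>k<m. j * k) = j * (\<Sum>k<m. k)" for j m :: nat
    by (simp add: sum_distrib_left)
  \<comment> \<open>Adding \<open>n\<close>, respectively \<open>2 * n\<close>, removes the
    truncated subtraction.\<close>
  moreover have "n * (n - 1) + n = n * n" "2 * n * (2 * n - 1) + 2 * n = 4 * (n * n)"
    by (simp_all add: n_def algebra_simps)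
  moreover have double: "(\<Sum>k<2 * n. k) = n * n + 2 * (\<Sum>k<n. k)"
    using gauss[of n] gauss[of "2 * n"] by simp
  moreover have "s * (n * n) = 2 * (s * (\<Sum>k<n. k)) + s * n"
    by (simp only: gauss[of n, symmetric] distrib_left mult.left_commute)
  moreover note Suc[folded n_def] gauss[of n]
  ultimately have "2 * (Suc s * (\<Sum>k<2 * n. k)) + 2 * n
      = 4 * (\<Sum>k<2 * n. binary_edges k) + 2 * n * (2 * n - 1) + 2 * n"
    unfolding mult_Suc distrib_left double by simp
  then show ?case
    by (simp add: n_def sum_distrib_left)
qed simp

lemma embedding_wirelength_ge:
  assumes "is_embedding (hypercube (s + 3)) (cylinder 8 (2 ^ s)) f P"
  shows "4 * 4 ^ s + 16 * 2 ^ s \<le> embedding_wirelength (hypercube (s + 3)) P"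
proof -
  let ?Q = "hypercube (s + 3)" and ?n = "2 ^ s :: nat"
  have bij: "bij_betw f (verts ?Q) (verts (cylinder 8 ?n))"
    using assms by (simp add: is_embedding_def)
  have row: "8 * (s * k) \<le> cut_size ?Q (f -` row_cut k) + 16 * binary_edges k" if "k < ?n" for k
  proof -
    \<comment> \<open>The first \<open>k\<close> rows hold \<open>8 * k\<close> vertices; the three
      extra dimensions cancel against the 3 in \<open>binary_edges_power\<close>.\<close>
    have "(s + 3) * (2 ^ 3 * k) \<le> cut_size ?Q (f -` row_cut k) + 2 * binary_edges (2 ^ 3 * k)"
      using that
      by (intro cut_size_preimage_ge[OF bij, where D = "{..<8} \<times> {..<k}"])
         (auto simp: row_cut_def verts_cylinder)
    then show ?thesis
      unfolding binary_edges_power by (simp add: algebra_simps)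
  qed
  have "8 * (\<Sum>k<?n. s * k) \<le>
      (\<Sum>k<?n. cut_size ?Q (f -` row_cut k)) + 16 * (\<Sum>k<?n. binary_edges k)"
    unfolding sum_distrib_left sum.distrib[symmetric] by (intro sum_mono row) simp
  with sum_binary_edges[of s]
  have rows: "4 * (?n * (?n - 1)) \<le> (\<Sum>k<?n. cut_size ?Q (f -` row_cut k))"
    by linarith
  have column: "10 * ?n \<le> cut_size ?Q (f -` column_cut i) + cut_size ?Q (f -` column_cut (Suc i))"
    if "i < 4" for i
  proof -
    \<comment> \<open>Per unit of \<open>?n\<close>, the isoperimetric bound is
      \<open>3 (s + 3) - (3 s + 4) = 5\<close> for three columns and
      \<open>5 (s + 3) - (5 s + 10) = 5\<close> for five. As \<open>i < 4\<close>, the five columns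
      do not wrap around.\<close>
    have small: "binary_edges 3 = 2" "binary_edges 5 = 5"
      by (simp_all add: binary_edges.simps)
    have "(s + 3) * (?n * 3) \<le> cut_size ?Q (f -` (column_cut i \<inter> column_cut (Suc i)))
        + 2 * binary_edges (?n * 3)"
      using that
      by (intro cut_size_preimage_ge[OF bij, where D = "{Suc i..<i + 4} \<times> {..<?n}"])
         (auto simp: column_cut_def verts_cylinder)
    moreover have "(s + 3) * (?n * 5) \<le> cut_size ?Q (f -` (column_cut i \<union> column_cut (Suc i)))
        + 2 * binary_edges (?n * 5)"
      using that
      by (intro cut_size_preimage_ge[OF bij, where D = "{i..<i + 5} \<times> {..<?n}"])
         (auto simp: column_cut_def verts_cylinder)
    ultimately show ?thesis
      using cut_size_submodular[OF simple_graph_hypercube[of "s + 3"],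
          of "f -` column_cut i" "f -` column_cut (Suc i)"]
      unfolding binary_edges_power small by (simp add: algebra_simps)
  qed
  \<comment> \<open>On the cylinder, \<open>column_cut 4\<close> is the complement of
    \<open>column_cut 0\<close>, which closes the chain of consecutive pairs cyclically.\<close>
  have "cut_size ?Q (f -` column_cut 4) = cut_size ?Q (- (f -` column_cut 0))"
  proof (rule cut_size_cong[OF simple_graph_hypercube])
    fix x assume "x \<in> verts ?Q"
    then have "f x \<in> verts (cylinder 8 ?n)"
      using bij by (auto simp: bij_betw_def)
    then show "x \<in> f -` column_cut 4 \<longleftrightarrow> x \<in> - (f -` column_cut 0)"
      by (auto simp: column_cut_def verts_cylinder)
  qed
  then have wrap: "cut_size ?Q (f -` column_cut 4) = cut_size ?Q (f -` column_cut 0)"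
    by (simp add: cut_size_def separates_Compl)
  \<comment> \<open>The four pair bounds add up to \<open>40 * ?n\<close> and count each column cut
    twice.\<close>
  have "20 * ?n \<le> (\<Sum>i<4. cut_size ?Q (f -` column_cut i))"
    using column[of 0] column[of 1] column[of 2] column[of 3] wrap
    by (simp add: eval_nat_numeral)
  with rows have "4 * (?n * (?n - 1)) + 20 * ?n \<le>
      (\<Sum>i\<in>{..<4} <+> {..<?n}. cut_size ?Q (f -` case_sum column_cut row_cut i))"
    by (simp add: sum.Plus)
  also have "\<dots> \<le> embedding_wirelength ?Q P"
    by (rule embedding_wirelength_ge_cuts[OF assms cylinder_edge_separations])
  finally show ?thesis
    by (simp add: algebra_simps power_mult_distrib[symmetric])
qed

section \<open>Upper bound\<close>

text \<open>Paths may be chosen independently: distinct edges have distinct image pairs, so their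
  paths have different ends and \<open>P\<close> is injective.\<close>

lemma embedding_of_edge_paths:
  assumes G: "simple_graph G" and bij: "bij_betw f (verts G) (verts H)"
    and paths: "\<And>e. e \<in> edges G \<Longrightarrow>
      \<exists>p. is_path H p \<and> {hd p, last p} = f ` e \<and> path_length p = w e"
  obtains P where "is_embedding G H f P" "embedding_wirelength G P = (\<Sum>e\<in>edges G. w e)"
proof -
  obtain P where P: "\<And>e. e \<in> edges G \<Longrightarrow>
      is_path H (P e) \<and> {hd (P e), last (P e)} = f ` e \<and> path_length (P e) = w e"
    using paths by metis
  have "inj_on P (edges G)"
  proof (rule inj_onI)
    fix d e assume de: "d \<in> edges G" "e \<in> edges G" "P d = P e"
    then have "f ` d = f ` e"
      using P by metis
    moreover have "d \<subseteq> verts G" "e \<subseteq> verts G"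
      using de by (auto elim!: simple_graph_edgeE[OF G])
    ultimately show "d = e"
      using bij inj_on_image_eq_iff[of f "verts G" d e] by (simp add: bij_betw_def)
  qed
  with P bij have "is_embedding G H f P"
    by (simp add: is_embedding_def)
  moreover have "embedding_wirelength G P = (\<Sum>e\<in>edges G. w e)"
    unfolding embedding_wirelength_def using P by (intro sum.cong) auto
  ultimately show ?thesis
    by (rule that)
qed

section \<open>Explicit paths in the cylinder\<close>

definition spread :: "nat set \<Rightarrow> nat" where
  "spread X = Max X - Min X"

text \<open>On a pair below \<open>d\<close>, this is the distance in the cycle; the set argument
  suits unordered edges.\<close>

definition cyclic_spread :: "nat \<Rightarrow> nat set \<Rightarrow> nat" where
  "cyclic_spread d X = min (spread X) (d - spread X)"

lemma spread_doubleton: "spread {a, b} = max a b - min a b"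
  by (simp add: spread_def)

lemma spread_singleton [simp]: "spread {a} = 0"
  by (simp add: spread_def)

lemma cyclic_spread_singleton [simp]: "cyclic_spread d {a} = 0"
  by (simp add: cyclic_spread_def)

lemma cylinder_vertical_edge:
  "i < d \<Longrightarrow> Suc j < n \<Longrightarrow> {(i, j), (i, Suc j)} \<in> edges (cylinder d n)"
  unfolding cylinder_def cartesian_product_def cycle_graph_def path_graph_def by auto

lemma cylinder_horizontal_edge:
  "i < d \<Longrightarrow> j < n \<Longrightarrow> {(i, j), (Suc i mod d, j)} \<in> edges (cylinder d n)"
  unfolding cylinder_def cartesian_product_def cycle_graph_def path_graph_def by auto

lemma cylinder_vertical_path:
  assumes "i < d" "a < n" "b < n"
  shows "\<exists>p. is_path (cylinder d n) p \<and> {hd p, last p} = {(i, a), (i, b)} \<and>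
    path_length p = spread {a, b}"
  using assms
proof (induction a b rule: linorder_wlog)
  case (le a b)
  let ?p = "map (Pair i) [a..<Suc b]"
  have "is_path (cylinder d n) ?p"
    using le unfolding is_path_def
    by (auto simp: verts_cylinder distinct_map inj_on_def simp del: upt_Suc
        intro: cylinder_vertical_edge)
  moreover have "hd ?p = (i, a)"
    using le by (simp add: upt_conv_Cons del: upt_Suc)
  moreover have "last ?p = (i, b)"
    using le by simp
  moreover have "path_length ?p = spread {a, b}"
    using le by (simp add: path_length_def spread_doubleton)
  ultimately show ?case
    by metis
next
  case (sym a b)
  then show ?case
    by (simp add: insert_commute)
qed

lemma cylinder_arc:
  assumes "i < d" "j < n" "t < d"
  shows "\<exists>p. is_path (cylinder d n) p \<and> {hd p, last p} = {(i, j), ((i + t) mod d, j)} \<and>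
    path_length p = t"
proof -
  let ?p = "map (\<lambda>m. ((i + m) mod d, j)) [0..<Suc t]"
  have inj: "inj_on (\<lambda>m. ((i + m) mod d, j)) {0..<Suc t}"
  proof (rule linorder_inj_onI)
    fix m m' assume m: "m < m'" "m \<in> {0..<Suc t}" "m' \<in> {0..<Suc t}"
    \<comment> \<open>Two coinciding vertices would differ by a multiple of \<open>d\<close>, but
      \<open>0 < m' - m \<le> t < d\<close>.\<close>
    then have "\<not> d dvd m' - m"
      using \<open>t < d\<close> by (auto dest: dvd_imp_le)
    with m show "((i + m) mod d, j) \<noteq> ((i + m') mod d, j)"
      using mod_eq_dvd_iff_nat[of "i + m" "i + m'" d] by auto
  qed auto
  have "is_path (cylinder d n) ?p"
    using assms inj cylinder_horizontal_edge[of "(i + m) mod d" d j n for m] unfolding is_path_def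
    by (auto simp: verts_cylinder distinct_map mod_Suc_eq simp del: upt_Suc)
  moreover have "hd ?p = (i, j)"
    using assms by (simp add: upt_conv_Cons del: upt_Suc)
  moreover have "last ?p = ((i + t) mod d, j)"
    by simp
  moreover have "path_length ?p = t"
    by (simp add: path_length_def)
  ultimately show ?thesis
    by metis
qed

lemma cylinder_horizontal_path:
  assumes "a < d" "b < d" "a \<noteq> b" "j < n"
  shows "\<exists>p. is_path (cylinder d n) p \<and> {hd p, last p} = {(a, j), (b, j)} \<and>
    path_length p = cyclic_spread d {a, b}"
  using assms
proof (induction a b rule: linorder_wlog)
  case (le a b)
  show ?case
  proof (cases "b - a \<le> d - (b - a)")
    case True
    have "(a + (b - a)) mod d = b" using le by simp
    with cylinder_arc[of a d j n "b - a"] True le show ?thesis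
      by (simp add: cyclic_spread_def spread_doubleton)
  next
    case False
    \<comment> \<open>The shorter arc starts at \<open>b\<close> and passes through the wraparound
      edge to \<open>a\<close>.\<close>
    have "b + (d - (b - a)) = d + a" using le by simp
    with cylinder_arc[of b d j n "d - (b - a)"] False le show ?thesis
      by (simp add: cyclic_spread_def spread_doubleton insert_commute)
  qed
next
  case (sym a b)
  then show ?case
    by (simp add: insert_commute)
qed

section \<open>The Gray code layout\<close>

abbreviation binary_value :: "bool list \<Rightarrow> nat" where
  "binary_value \<equiv> horner_sum of_bool 2"

text \<open>The index of the word \<open>a b c\<close> in the reflected Gray code: its binary digits
  are the prefix parities. Cyclically consecutive positions hold adjacent vertices of the
  3-cube.\<close>

definition gray_position :: "bool \<Rightarrow> bool \<Rightarrow> bool \<Rightarrow> nat" where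
  "gray_position a b c = 4 * of_bool a + 2 * of_bool (a \<noteq> b) + of_bool ((a \<noteq> b) \<noteq> c)"

definition gray_layout :: "bool list \<Rightarrow> nat \<times> nat" where
  "gray_layout xs = (gray_position (xs ! 0) (xs ! 1) (xs ! 2), binary_value (drop 3 xs))"

lemma gray_layout_Cons [simp]:
  "gray_layout (a # b # c # xs) = (gray_position a b c, binary_value xs)"
  by (simp add: gray_layout_def)

lemma binary_value_less: "binary_value xs < 2 ^ length xs"
  by (induction xs) auto

lemma binary_value_inj:
  "length xs = length ys \<Longrightarrow> binary_value xs = binary_value ys \<Longrightarrow> xs = ys"
proof (induction xs ys rule: list_induct2)
  case (Cons x xs y ys)
  from Cons.prems have "of_bool x + 2 * binary_value xs = of_bool y + 2 * binary_value ys"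
    by simp
  then have "x = y \<and> binary_value xs = binary_value ys"
    by (cases x; cases y) (simp_all, presburger+)
  with Cons.IH show ?case
    by simp
qed simp

lemma gray_layout_bij:
  "bij_betw gray_layout (verts (hypercube (s + 3))) (verts (cylinder 8 (2 ^ s)))"
proof -
  have shape: "\<exists>a b c zs. xs = a # b # c # zs \<and> length zs = s"
    if "xs \<in> verts (hypercube (s + 3))" for xs
    using that by (auto simp: verts_hypercube length_Suc_conv eval_nat_numeral)
  have "inj_on gray_layout (verts (hypercube (s + 3)))"
  proof (rule inj_onI)
    fix xs ys
    assume xy: "xs \<in> verts (hypercube (s + 3))" "ys \<in> verts (hypercube (s + 3))"
      "gray_layout xs = gray_layout ys"
    obtain a b c zs a' b' c' zs' where eq: "xs = a # b # c # zs" "length zs = s"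
      "ys = a' # b' # c' # zs'" "length zs' = s"
      using shape[OF xy(1)] shape[OF xy(2)] by blast
    have "gray_position a b c = gray_position a' b' c' \<Longrightarrow> a = a' \<and> b = b' \<and> c = c'"
      by (cases a; cases b; cases c; cases a'; cases b'; cases c') (simp_all add: gray_position_def)
    with xy(3) eq binary_value_inj show "xs = ys"
      by auto
  qed
  moreover have "gray_layout ` verts (hypercube (s + 3)) \<subseteq> verts (cylinder 8 (2 ^ s))"
  proof (rule image_subsetI)
    fix xs assume "xs \<in> verts (hypercube (s + 3))"
    then obtain a b c zs where "xs = a # b # c # zs" "length zs = s"
      using shape by blast
    then show "gray_layout xs \<in> verts (cylinder 8 (2 ^ s))"
      using binary_value_less[of zs] by (auto simp: verts_cylinder gray_position_def)
  qed
  moreover have "card (verts (hypercube (s + 3))) = card (verts (cylinder 8 (2 ^ s)))"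
    by (simp add: card_verts_hypercube card_verts_cylinder power_add)
  moreover have "finite (verts (cylinder 8 (2 ^ s)))"
    by (simp add: verts_cylinder)
  ultimately show ?thesis
    unfolding bij_betw_def by (metis card_image card_subset_eq)
qed

text \<open>A hypercube edge changes only the column or only the row, so one summand
  vanishes.\<close>

definition layout_cost :: "bool list set \<Rightarrow> nat" where
  "layout_cost e = cyclic_spread 8 (fst ` gray_layout ` e) + spread (snd ` gray_layout ` e)"

text \<open>An edge in one of the first three coordinates stays in its row, any other edge in its
  column, so a single arc or straight segment suffices.\<close>

lemma gray_layout_path:
  assumes "e \<in> edges (hypercube (s + 3))"
  shows "\<exists>p. is_path (cylinder 8 (2 ^ s)) p \<and> {hd p, last p} = gray_layout ` e \<and>
    path_length p = layout_cost e"
proof -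
  have gray_less: "gray_position a b c < 8" for a b c
    by (simp add: gray_position_def)
  have vertical: ?thesis if e': "e' \<in> edges (hypercube s)" "e = Cons a ` Cons b ` Cons c ` e'" for a b c e'
  proof -
    from simple_graph_edgeE[OF simple_graph_hypercube e'(1)] obtain u v
      where uv: "e' = {u, v}" "length u = s" "length v = s"
      by (metis verts_hypercube mem_Collect_eq)
    then have "binary_value u < 2 ^ s" "binary_value v < 2 ^ s"
      using binary_value_less by metis+
    with e' uv cylinder_vertical_path[OF gray_less] show ?thesis
      by (simp add: layout_cost_def)
  qed
  have horizontal: ?thesis
    if e': "e = {a # b # c # xs, a' # b' # c' # xs}" "length xs = s"
      "gray_position a b c \<noteq> gray_position a' b' c'" for a b c a' b' c' xs
  proof -
    have "binary_value xs < 2 ^ s"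
      using binary_value_less e' by metis
    with e' cylinder_horizontal_path[OF gray_less gray_less] show ?thesis
      by (simp add: layout_cost_def)
  qed
  have "e \<in> edges (hypercube (Suc (Suc (Suc s))))"
    using assms by (simp add: eval_nat_numeral)
  then show ?thesis
  proof (cases rule: edge_hypercube_Suc_cases)
    case (same a e1)
    from same(2) show ?thesis
    proof (cases rule: edge_hypercube_Suc_cases)
      case same2: (same b e2)
      from same2(2) show ?thesis
      proof (cases rule: edge_hypercube_Suc_cases)
        case same3: (same c e3)
        with same(1) same2(1) show ?thesis
          by (intro vertical) simp_all
      next
        case (flip xs)
        with same(1) same2(1) show ?thesis
          by (intro horizontal[of a b False xs a b True]) (auto simp: gray_position_def)
      qed
    next
      case (flip xs)
      then obtain c ys where "xs = c # ys" "length ys = s"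
        by (auto simp: length_Suc_conv)
      with flip same(1) show ?thesis
        by (intro horizontal[of a False c ys a True c]) (auto simp: gray_position_def)
    qed
  next
    case (flip xs)
    then obtain b c ys where "xs = b # c # ys" "length ys = s"
      by (auto simp: length_Suc_conv)
    with flip show ?thesis
      by (intro horizontal[of False b c ys True b c]) (auto simp: gray_position_def)
  qed
qed

text \<open>The head is the lowest bit: its \<open>2 ^ s\<close> edges cost 1 each, while the costs
  in both subcubes double. The total thus satisfies \<open>W' = 4 * W + 2 ^ s\<close>.\<close>

lemma sum_spread_binary_value:
  "2 * (\<Sum>e\<in>edges (hypercube s). spread (binary_value ` e)) + 2 ^ s = 4 ^ s"
proof (induction s)
  case (Suc s)
  have scale: "spread (binary_value ` Cons b ` e) = 2 * spread (binary_value ` e)"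
    if e: "e \<in> edges (hypercube s)" for b e
  proof -
    from simple_graph_edgeE[OF simple_graph_hypercube e] obtain u v where "e = {u, v}"
      by metis
    then show ?thesis
      by (auto simp: spread_doubleton max_def min_def)
  qed
  have "(\<Sum>e\<in>edges (hypercube (Suc s)). spread (binary_value ` e)) =
      4 * (\<Sum>e\<in>edges (hypercube s). spread (binary_value ` e)) + 2 ^ s"
    by (simp add: sum_edges_hypercube_Suc scale spread_doubleton card_verts_hypercube
        sum_distrib_left[symmetric])
  then show ?case
    using Suc by (simp add: algebra_simps)
qed (simp add: edges_hypercube_0)

lemma sum_layout_cost:
  "(\<Sum>e\<in>edges (hypercube (s + 3)). layout_cost e) = 4 * 4 ^ s + 16 * 2 ^ s"
proof -
  have vertical: "layout_cost (Cons a ` Cons b ` Cons c ` e) = spread (binary_value ` e)"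
    if e: "e \<in> edges (hypercube s)" for a b c e
  proof -
    from simple_graph_edgeE[OF simple_graph_hypercube e] obtain u v where "e = {u, v}"
      by metis
    then show ?thesis
      by (simp add: layout_cost_def)
  qed
  have horizontal: "layout_cost {a # b # c # xs, a' # b' # c' # xs} =
      cyclic_spread 8 {gray_position a b c, gray_position a' b' c'}" for a b c a' b' c' xs
    by (simp add: layout_cost_def)
  have three: "s + 3 = Suc (Suc (Suc s))"
    by simp
  \<comment> \<open>There are 8 columns, each numbered in binary, and \<open>2 ^ s\<close> rows. In
    each row, 8 of the 12 edges of the 3-cube follow the cycle at cost 1 and the other 4 cost 3,
    giving 20.\<close>
  have "(\<Sum>e\<in>edges (hypercube (s + 3)). layout_cost e) =
      8 * (\<Sum>e\<in>edges (hypercube s). spread (binary_value ` e)) + 20 * 2 ^ s"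
    by (simp add: three sum_edges_hypercube_Suc sum_verts_hypercube_Suc vertical horizontal
       cyclic_spread_def spread_doubleton gray_position_def card_verts_hypercube)
  with sum_spread_binary_value[of s] show ?thesis
    by simp
qed

text \<open>The Gray layout attains the lower bound, so the infimum is a minimum.\<close>

theorem wirelength_hypercube_cylinder:
  "wirelength (hypercube (s + 3)) (cylinder 8 (2 ^ s)) = 4 * 4 ^ s + 16 * 2 ^ s"
proof -
  obtain P where P: "is_embedding (hypercube (s + 3)) (cylinder 8 (2 ^ s)) gray_layout P"
    "embedding_wirelength (hypercube (s + 3)) P = 4 * 4 ^ s + 16 * 2 ^ s"
    using embedding_of_edge_paths[OF simple_graph_hypercube gray_layout_bij gray_layout_path] sum_layout_cost
    by metis
  show ?thesis
    unfolding wirelength_def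
  proof (rule cInf_eq_minimum)
    show "4 * 4 ^ s + 16 * 2 ^ s \<in> {embedding_wirelength (hypercube (s + 3)) P | f P.
        is_embedding (hypercube (s + 3)) (cylinder 8 (2 ^ s)) f P}"
      using P by (metis (mono_tags, lifting) mem_Collect_eq)
  qed (auto dest: embedding_wirelength_ge)
qed

theorem theorem2p3:
  fixes r r1 r2 :: nat
  assumes "r \<ge> 3" and "r1 = 3" and "r2 = r - 3"
  shows "(of_nat (wirelength (hypercube r) (cylinder (2 ^ 3) (2 ^ (r - 3)))) :: rat) =
    2 ^ r1 * (2 powi (2 * int r2 - 1) - 2 powi (int r2 - 1)) +
    2 ^ r2 * (3 * 2 powi (2 * int r1 - 3) - 2 powi (int r1 - 1))"
proof -
  have "r = r2 + 3"
    using assms by simp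
  then have "wirelength (hypercube r) (cylinder (2 ^ 3) (2 ^ (r - 3))) = 4 * 4 ^ r2 + 16 * 2 ^ r2"
    using wirelength_hypercube_cylinder[of r2] by simp
  \<comment> \<open>For \<open>r2 = 0\<close> the exponent is negative, so the power becomes a
    quotient. The second bracket of the formula is \<open>3 * 2 ^ 3 - 2 ^ 2 = 20\<close>.\<close>
  moreover have "(2::rat) powi (2 * int r2 - 1) = 4 ^ r2 / 2"
    by (simp add: power_int_diff power_int_mult)
  moreover have "(2::rat) powi (int r2 - 1) = 2 ^ r2 / 2"
    by (simp add: power_int_diff)
  ultimately show ?thesis
    using assms by simp
qed

end
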